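(* Let $G$ be a super edge-magic graph of size $|E(G)| = 2|V(G)|-4$. Then $|\sigma_G| = 2$, where $\sigma_G$ is the super edge-magic set of $G$.
   Context: Graphs are finite and simple. The notation $[a,b]$ denotes the set of integers $x$ with $a\le x\le b$. An edge-magic labeling of a graph $G$ is a bijection $f:V(G)\cup E(G)\to[1,|V(G)|+|E(G)|]$ such that $f(u)+f(v)+f(uv)$ equals a constant (the valence $\mathrm{val}(f)$ of $f$) for every $uv\in E(G)$. It is super edge-magic if moreover $f(V(G))=[1,|V(G)|]$, and $G$ is super edge-magic if it admits a super edge-magic labeling. For a graph $G$ of order $p$ and size $q$ (with $q\geq 1$, so that the expression below makes sense), let $$S_G=\left\{\frac{\sum_{u\in V(G)}\deg(u)g(u)+\sum_{i=p+1}^{p+q} i}{q} : g:V(G)\to[1,p]\text{ bijective}\right\}.$$ If $\lceil\min S_G\rceil\le\lfloor\max S_G\rfloor$, the super edge-magic interval of $G$ is $I_G=[\lceil\min S_G\rceil,\lfloor\max S_G\rfloor]$. The super edge-magic set of $G$ is $$\sigma_G=\{k\in I_G : \text{there exists a super edge-magic labeling of } G\text{ with valence } k\}.$$ *)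

theory Defs
  imports Complex_Main
begin

text \<open>Finite simple graphs are given by a vertex set and a set of two-element subsets of it.\<close>

definition simple_graph :: "'a set \<Rightarrow> 'a set set \<Rightarrow> bool" where
  "simple_graph V E \<longleftrightarrow> finite V \<and> E \<subseteq> {{u, v} | u v. u \<in> V \<and> v \<in> V \<and> u \<noteq> v}"

definition degree :: "'a set set \<Rightarrow> 'a \<Rightarrow> nat" where
  "degree E u = card {e \<in> E. u \<in> e}"

text \<open>A labeling of vertices and edges is a function on the disjoint union of the two sets:
  \<open>f (Inl u)\<close> is the label of the vertex \<open>u\<close> and \<open>f (Inr e)\<close> the label of the edge \<open>e\<close>.
  The valence is rendered as a relation; it is unique as soon as the graph has an edge.\<close>

definition has_valence :: "'a set set \<Rightarrow> ('a + 'a set \<Rightarrow> int) \<Rightarrow> int \<Rightarrow> bool" where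
  "has_valence E f k \<longleftrightarrow> (\<forall>u v. {u, v} \<in> E \<longrightarrow> f (Inl u) + f (Inl v) + f (Inr {u, v}) = k)"

definition edge_magic_labeling ::
    "'a set \<Rightarrow> 'a set set \<Rightarrow> ('a + 'a set \<Rightarrow> int) \<Rightarrow> bool" where
  "edge_magic_labeling V E f \<longleftrightarrow>
     bij_betw f (V <+> E) {1..int (card V) + int (card E)} \<and> (\<exists>k. has_valence E f k)"

definition super_edge_magic_labeling ::
    "'a set \<Rightarrow> 'a set set \<Rightarrow> ('a + 'a set \<Rightarrow> int) \<Rightarrow> bool" where
  "super_edge_magic_labeling V E f \<longleftrightarrow>
     edge_magic_labeling V E f \<and> f ` (Inl ` V) = {1..int (card V)}"

definition super_edge_magic :: "'a set \<Rightarrow> 'a set set \<Rightarrow> bool" where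
  "super_edge_magic V E \<longleftrightarrow> (\<exists>f. super_edge_magic_labeling V E f)"

definition S_set :: "'a set \<Rightarrow> 'a set set \<Rightarrow> real set" where
  "S_set V E =
     {(real_of_int (\<Sum>u\<in>V. int (degree E u) * g u)
        + real_of_int (\<Sum>i = int (card V) + 1..int (card V) + int (card E). i))
       / real (card E) | g. bij_betw g V {1..int (card V)}}"

text \<open>For a finite vertex set, \<open>S_set V E\<close> is finite and nonempty, so \<open>Min\<close> and \<open>Max\<close> are genuine.
  The interval below is empty when the ceiling of the minimum exceeds the floor of the maximum.\<close>

definition super_edge_magic_interval :: "'a set \<Rightarrow> 'a set set \<Rightarrow> int set" where
  "super_edge_magic_interval V E = {\<lceil>Min (S_set V E)\<rceil>..\<lfloor>Max (S_set V E)\<rfloor>}"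

definition super_edge_magic_set :: "'a set \<Rightarrow> 'a set set \<Rightarrow> int set" where
  "super_edge_magic_set V E =
     {k \<in> super_edge_magic_interval V E.
        \<exists>f. super_edge_magic_labeling V E f \<and> has_valence E f k}"

end

theory Submission
  imports Defs "HOL-Library.FuncSet"
begin

text \<open>Edge labels fill \<open>{p+1..p+q}\<close> and the endpoint labels of an edge sum to between \<open>3\<close> and
  \<open>2p-1\<close>, so looking at the edges labelled \<open>p+q\<close> and \<open>p+1\<close> the valence lies in \<open>{p+q+3..3p}\<close>.
  For \<open>q = 2p-4\<close> this interval is \<open>{3p-1, 3p}\<close>, and the complementary labeling, which reflects
  vertex labels and edge labels separately, exchanges its two elements. Summing the valence
  over all edges shows that a valence is always an element of \<open>S_G\<close>.\<close>

lemma simple_graph_edgeE: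
  assumes "simple_graph V E" "e \<in> E"
  obtains u v where "e = {u, v}" "u \<in> V" "v \<in> V" "u \<noteq> v"
  using assms unfolding simple_graph_def by blast

lemma simple_graph_finite:
  assumes "simple_graph V E"
  shows "finite V" "finite E"
proof -
  show "finite V"
    using assms by (simp add: simple_graph_def)
  moreover have "E \<subseteq> Pow V"
    using assms by (auto simp: simple_graph_def)
  ultimately show "finite E"
    by (meson finite_Pow_iff finite_subset)
qed

lemma super_edge_magic_labeling_vertices:
  assumes "super_edge_magic_labeling V E f"
  shows "bij_betw (\<lambda>u. f (Inl u)) V {1..int (card V)}"
proof -
  have "inj_on f (V <+> E)" "f ` (Inl ` V) = {1..int (card V)}"
    using assms
    by (auto simp: super_edge_magic_labeling_def edge_magic_labeling_def bij_betw_def)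
  then show ?thesis
    by (auto simp: bij_betw_def inj_on_def image_image)
qed

text \<open>Since \<open>f\<close> is injective on the disjoint union, the labels of the edges are
  exactly those that the vertices leave over.\<close>

lemma super_edge_magic_labeling_edges:
  assumes "super_edge_magic_labeling V E f"
  shows "bij_betw (\<lambda>e. f (Inr e)) E {int (card V) + 1..int (card V) + int (card E)}"
proof -
  have inj: "inj_on f (V <+> E)"
    and im: "f ` (V <+> E) = {1..int (card V) + int (card E)}"
    and imV: "f ` (Inl ` V) = {1..int (card V)}"
    using assms
    by (auto simp: super_edge_magic_labeling_def edge_magic_labeling_def bij_betw_def)
  have "Inr ` E = (V <+> E) - Inl ` V"
    by auto
  then have "f ` (Inr ` E) = f ` (V <+> E) - f ` (Inl ` V)"
    using inj_on_image_set_diff[OF inj, of "V <+> E" "Inl ` V"] by auto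
  also have "\<dots> = {int (card V) + 1..int (card V) + int (card E)}"
    unfolding im imV by auto
  finally show ?thesis
    using inj by (auto simp: bij_betw_def inj_on_def image_image)
qed

text \<open>Converse of the two preceding lemmas: it lets a labeling be built and checked on
  vertices and edges separately, as the complementary labeling requires.\<close>

lemma super_edge_magic_labelingI:
  assumes V: "bij_betw (\<lambda>u. f (Inl u)) V {1..int (card V)}"
    and E: "bij_betw (\<lambda>e. f (Inr e)) E {int (card V) + 1..int (card V) + int (card E)}"
    and k: "has_valence E f k"
  shows "super_edge_magic_labeling V E f"
proof -
  have imV: "f ` (Inl ` V) = {1..int (card V)}"
    using V by (auto simp: bij_betw_def image_image)
  have "bij_betw f (Inl ` V) {1..int (card V)}"
    using V by (auto simp: bij_betw_def inj_on_def image_image)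
  moreover have "bij_betw f (Inr ` E) {int (card V) + 1..int (card V) + int (card E)}"
    using E by (auto simp: bij_betw_def inj_on_def image_image)
  ultimately have "bij_betw f (Inl ` V \<union> Inr ` E)
      ({1..int (card V)} \<union> {int (card V) + 1..int (card V) + int (card E)})"
    by (rule bij_betw_combine) auto
  moreover have "{1..int (card V)} \<union> {int (card V) + 1..int (card V) + int (card E)}
      = {1..int (card V) + int (card E)}"
    by auto
  ultimately have "bij_betw f (V <+> E) {1..int (card V) + int (card E)}"
    by (simp add: Plus_def)
  with imV k show ?thesis
    by (auto simp: super_edge_magic_labeling_def edge_magic_labeling_def)
qed

lemma super_edge_magic_valence_bounds:
  assumes G: "simple_graph V E" and q: "card E \<ge> 1"
    and f: "super_edge_magic_labeling V E f" and k: "has_valence E f k"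
  shows "k \<in> {int (card V) + int (card E) + 3..3 * int (card V)}"
proof -
  let ?p = "int (card V)" and ?q = "int (card E)"
  note bV = super_edge_magic_labeling_vertices[OF f]
  note bE = super_edge_magic_labeling_edges[OF f]
  \<comment> \<open>The endpoints are distinct, so their labels sum to at least \<open>1 + 2\<close>
    and at most \<open>(p - 1) + p\<close>.\<close>
  have sum_bounds: "3 \<le> k - f (Inr e) \<and> k - f (Inr e) \<le> 2 * ?p - 1" if eE: "e \<in> E" for e
  proof -
    obtain u v where e: "e = {u, v}" "u \<in> V" "v \<in> V" "u \<noteq> v"
      using simple_graph_edgeE[OF G eE] .
    then have "f (Inl u) \<noteq> f (Inl v)"
      using bV by (auto simp: bij_betw_def inj_on_def)
    moreover have "f (Inl u) \<in> {1..?p}" "f (Inl v) \<in> {1..?p}"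
      using bij_betwE[OF bV] e by auto
    moreover have "k - f (Inr e) = f (Inl u) + f (Inl v)"
      using k eE e unfolding has_valence_def by force
    ultimately show ?thesis
      by auto
  qed
  \<comment> \<open>As \<open>q \<ge> 1\<close>, both extreme edge labels occur:
    \<open>p + 1\<close> forces \<open>k \<le> (p + 1) + (2 * p - 1)\<close>, and
    \<open>p + q\<close> forces \<open>k \<ge> (p + q) + 3\<close>.\<close>
  have "?p + 1 \<in> (\<lambda>e. f (Inr e)) ` E" "?p + ?q \<in> (\<lambda>e. f (Inr e)) ` E"
    using bE q by (auto simp: bij_betw_def)
  then obtain a b where "a \<in> E" "f (Inr a) = ?p + 1" "b \<in> E" "f (Inr b) = ?p + ?q"
    by (elim imageE) auto
  with sum_bounds[of a] sum_bounds[of b] show ?thesis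
    by auto
qed

lemma super_edge_magic_complement:
  assumes f: "super_edge_magic_labeling V E f" and k: "has_valence E f k"
  obtains g where "super_edge_magic_labeling V E g"
    "has_valence E g (4 * int (card V) + int (card E) + 3 - k)"
proof -
  let ?p = "int (card V)" and ?q = "int (card E)"
  define g where "g = case_sum (\<lambda>u. ?p + 1 - f (Inl u)) (\<lambda>e. 2 * ?p + ?q + 1 - f (Inr e))"
  have "bij_betw (\<lambda>i. ?p + 1 - i) {1..?p} {1..?p}"
    by (rule bij_betwI[where g = "\<lambda>i. ?p + 1 - i"]) auto
  from bij_betw_trans[OF super_edge_magic_labeling_vertices[OF f] this]
  have V: "bij_betw (\<lambda>u. g (Inl u)) V {1..?p}"
    by (simp add: g_def comp_def)
  have "bij_betw (\<lambda>i. 2 * ?p + ?q + 1 - i) {?p + 1..?p + ?q} {?p + 1..?p + ?q}"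
    by (rule bij_betwI[where g = "\<lambda>i. 2 * ?p + ?q + 1 - i"]) auto
  from bij_betw_trans[OF super_edge_magic_labeling_edges[OF f] this]
  have E: "bij_betw (\<lambda>e. g (Inr e)) E {?p + 1..?p + ?q}"
    by (simp add: g_def comp_def)
  \<comment> \<open>Each endpoint contributes \<open>p + 1\<close> and the edge
    \<open>2 * p + q + 1\<close>, which add up to \<open>4 * p + q + 3\<close>; the old labels are
    subtracted from this.\<close>
  have k': "has_valence E g (4 * ?p + ?q + 3 - k)"
    unfolding has_valence_def
  proof (intro allI impI)
    fix u v assume "{u, v} \<in> E"
    then have "f (Inl u) + f (Inl v) + f (Inr {u, v}) = k"
      using k by (simp add: has_valence_def)
    then show "g (Inl u) + g (Inl v) + g (Inr {u, v}) = 4 * ?p + ?q + 3 - k"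
      by (simp add: g_def)
  qed
  from that super_edge_magic_labelingI[OF V E k'] k' show thesis
    by blast
qed

text \<open>Double counting of incident pairs: a vertex contributes its weight once for every edge
  containing it.\<close>

lemma sum_degree_mult:
  fixes g :: "'a \<Rightarrow> int"
  assumes "simple_graph V E"
  shows "(\<Sum>u\<in>V. int (degree E u) * g u) = (\<Sum>e\<in>E. \<Sum>u\<in>e. g u)"
proof -
  note fin = simple_graph_finite[OF assms]
  have sub: "e \<subseteq> V" if "e \<in> E" for e
    using assms that by (auto elim: simple_graph_edgeE)
  have "(\<Sum>u\<in>V. int (degree E u) * g u) = (\<Sum>u\<in>V. \<Sum>e | e \<in> E \<and> u \<in> e. g u)"
    by (simp add: degree_def)
  also have "\<dots> = (\<Sum>e\<in>E. \<Sum>u | u \<in> V \<and> u \<in> e. g u)"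
    using fin by (rule sum.swap_restrict)
  also have "\<dots> = (\<Sum>e\<in>E. \<Sum>u\<in>e. g u)"
    using sub by (intro sum.cong refl) auto
  finally show ?thesis .
qed

lemma valence_in_S_set:
  assumes G: "simple_graph V E" and q: "card E \<ge> 1"
    and f: "super_edge_magic_labeling V E f" and k: "has_valence E f k"
  shows "real_of_int k \<in> S_set V E"
proof -
  let ?p = "int (card V)" and ?q = "int (card E)"
  let ?A = "\<Sum>u\<in>V. int (degree E u) * f (Inl u)" and ?B = "\<Sum>i = ?p + 1..?p + ?q. i"
  have "?B = (\<Sum>e\<in>E. f (Inr e))"
    using sum.reindex_bij_betw[OF super_edge_magic_labeling_edges[OF f], of "\<lambda>i. i"] by simp
  then have "?A + ?B = (\<Sum>e\<in>E. (\<Sum>u\<in>e. f (Inl u)) + f (Inr e))"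
    by (simp add: sum_degree_mult[OF G] sum.distrib)
  also have "\<dots> = (\<Sum>e\<in>E. k)"
  proof (rule sum.cong[OF refl])
    fix e assume "e \<in> E"
    then obtain u v where "e = {u, v}" "u \<noteq> v"
      using simple_graph_edgeE[OF G] by metis
    then show "(\<Sum>u\<in>e. f (Inl u)) + f (Inr e) = k"
      using k \<open>e \<in> E\<close> by (simp add: has_valence_def)
  qed
  finally have "?A + ?B = ?q * k"
    by simp
  from arg_cong[OF this, of real_of_int]
  have "real_of_int ?A + real_of_int ?B = real (card E) * real_of_int k"
    by (simp only: of_int_add of_int_mult of_int_of_nat_eq)
  then have "real_of_int k = (real_of_int ?A + real_of_int ?B) / real (card E)"
    using q by simp
  \<comment> \<open>The vertex part of the labeling is itself the bijection that witnesses
    membership.\<close>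
  with super_edge_magic_labeling_vertices[OF f] show ?thesis
    unfolding S_set_def by (intro CollectI exI[of _ "\<lambda>u. f (Inl u)"] conjI)
qed

text \<open>A bijection on \<open>V\<close> is a total function with arbitrary values outside
  \<open>V\<close>, so there may be infinitely many. The quotient reads only the values on
  \<open>V\<close>, hence the finitely many extensional functions already give all elements.\<close>

lemma finite_S_set:
  assumes "finite V"
  shows "finite (S_set V E)"
proof -
  let ?P = "V \<rightarrow>\<^sub>E {1..int (card V)}"
  let ?s = "\<lambda>g. (real_of_int (\<Sum>u\<in>V. int (degree E u) * g u)
        + real_of_int (\<Sum>i = int (card V) + 1..int (card V) + int (card E). i)) / real (card E)"
  have "S_set V E \<subseteq> ?s ` ?P"
  proof
    fix x assume "x \<in> S_set V E"
    then obtain g where g: "bij_betw g V {1..int (card V)}" and x: "x = ?s g"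
      unfolding S_set_def by blast
    have "restrict g V \<in> ?P"
      using bij_betwE[OF g] by auto
    moreover have "x = ?s (restrict g V)"
      unfolding x by simp
    ultimately show "x \<in> ?s ` ?P"
      by blast
  qed
  moreover have "finite ?P"
    using assms by (intro finite_PiE) auto
  ultimately show ?thesis
    by (meson finite_imageI finite_subset)
qed

text \<open>Every valence is an element of \<open>S_set V E\<close>, hence lies between its minimum
  and maximum; being an integer, it survives the rounding of these bounds, so the interval excludes
  no valence.\<close>

lemma super_edge_magic_set_iff:
  assumes "simple_graph V E" "card E \<ge> 1"
  shows "k \<in> super_edge_magic_set V E \<longleftrightarrow>
    (\<exists>f. super_edge_magic_labeling V E f \<and> has_valence E f k)"
proof -
  have "k \<in> super_edge_magic_interval V E"
    if "super_edge_magic_labeling V E f" "has_valence E f k" for f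
  proof -
    note finite_S_set[OF simple_graph_finite(1)[OF assms(1)], of E]
      and valence_in_S_set[OF assms that]
    then have "Min (S_set V E) \<le> real_of_int k" "real_of_int k \<le> Max (S_set V E)"
      by simp_all
    then show ?thesis
      by (simp add: super_edge_magic_interval_def ceiling_le_iff le_floor_iff)
  qed
  then show ?thesis
    by (auto simp: super_edge_magic_set_def)
qed

theorem theorem2p2:
  fixes V :: "'a set" and E :: "'a set set"
  assumes "simple_graph V E"
    and "card E \<ge> 1"
    and "super_edge_magic V E"
    and "int (card E) = 2 * int (card V) - 4"
  shows "card (super_edge_magic_set V E) = 2"
proof -
  let ?p = "int (card V)" and ?\<sigma> = "super_edge_magic_set V E"
  note iff = super_edge_magic_set_iff[OF assms(1,2)]
  have sub: "?\<sigma> \<subseteq> {3 * ?p - 1, 3 * ?p}"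
  proof
    fix k assume "k \<in> ?\<sigma>"
    \<comment> \<open>With \<open>q = 2 * p - 4\<close> the lower end is \<open>3 * p - 1\<close>,
      which leaves two integers.\<close>
    then have "k \<in> {?p + int (card E) + 3..3 * ?p}"
      using super_edge_magic_valence_bounds[OF assms(1,2)] iff by blast
    with assms(4) show "k \<in> {3 * ?p - 1, 3 * ?p}"
      by auto
  qed
  have compl: "6 * ?p - 1 - k \<in> ?\<sigma>" if k: "k \<in> ?\<sigma>" for k
  proof -
    obtain f where f: "super_edge_magic_labeling V E f" "has_valence E f k"
      using k iff by blast
    obtain g where g: "super_edge_magic_labeling V E g"
      "has_valence E g (4 * ?p + int (card E) + 3 - k)"
      using super_edge_magic_complement[OF f] .
    moreover have "4 * ?p + int (card E) + 3 - k = 6 * ?p - 1 - k"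
      using assms(4) by simp
    ultimately show ?thesis
      using iff by metis
  qed
  obtain k where "k \<in> ?\<sigma>"
    using assms(3) iff
    by (auto simp: super_edge_magic_def super_edge_magic_labeling_def edge_magic_labeling_def)
  \<comment> \<open>The two candidates add up to \<open>6 * p - 1\<close>, so whichever of them
    \<open>k\<close> is, its complement is the other.\<close>
  with sub compl[of k] have "{3 * ?p - 1, 3 * ?p} \<subseteq> ?\<sigma>"
    by auto
  with sub have "?\<sigma> = {3 * ?p - 1, 3 * ?p}"
    by blast
  then show ?thesis
    by simp
qed

end
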